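(* Let $f, g \in \mathcal C(\{0,1\}^{\mathbb N})$. Then the following assertions are equivalent: (i) $f$ and $g$ are conjugates, i.e. there is a homeomorphism $h$ of $\{0,1\}^{\mathbb N}$ onto itself with $f=h^{-1}gh$; (ii) there are decreasing null sequences $(\mathcal P_n)$ and $(\mathcal Q_n)$ of partitions of $\{0,1\}^{\mathbb N}$ and digraph isomorphisms $\nu_n : \operatorname{Gr}(f,\mathcal P_n) \to \operatorname{Gr}(g,\mathcal Q_n)$ so that the sequence $(\nu_n)$ commutes with refinements; (iii) there are decreasing null sequences $(\mathcal P_n)$ and $(\mathcal Q_n)$ of partitions of $\{0,1\}^{\mathbb N}$ and digraph isomorphisms $\nu_n : \operatorname{Gr}(f,\mathcal P_n) \to \operatorname{Gr}(g,\mathcal Q_n)$ so that both $(\nu_n)$ and $(\nu_n^{-1})$ asymptotically commute with refinements.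
   Context: $\mathbb N$ is the set of positive integers; sequences are indexed by $\mathbb N$. $\{0,1\}^{\mathbb N}$ has the product topology and the metric $d(\sigma,\tau)=1/n$, where $n$ is the least positive integer with $\sigma(n)\neq\tau(n)$, and $d(\sigma,\sigma)=0$. $\mathcal C(\{0,1\}^{\mathbb N})$ is the set of all continuous maps from $\{0,1\}^{\mathbb N}$ to itself. A partition of $\{0,1\}^{\mathbb N}$ is a finite collection of nonempty pairwise disjoint clopen sets whose union is $\{0,1\}^{\mathbb N}$. For a finite collection of nonempty subsets of $\{0,1\}^{\mathbb N}$, $\operatorname{mesh}$ is the maximum of the diameters of its members. A partition $\mathcal P$ is a refinement of $\mathcal Q$ if every $a\in\mathcal P$ is contained in some (necessarily unique) $\nu(a)\in\mathcal Q$; the map $\nu:\mathcal P\to\mathcal Q$ is the refinement map. A sequence $(\mathcal P_n)$ of partitions is null if $\operatorname{mesh}(\mathcal P_n)\to0$, and decreasing if $\mathcal P_{n+1}$ is a refinement of $\mathcal P_n$ for every $n$. For a partition $\mathcal P$, $\operatorname{Gr}(f,\mathcal P)$ is the digraph with vertex set $\mathcal P$ in which $\overrightarrow{ab}$ is an edge if and only if $f(a)\cap b\neq\emptyset$. A digraph isomorphism is a bijection $\nu$ between vertex sets such that $\overrightarrow{ab}$ is an edge if and only if $\overrightarrow{\nu(a)\nu(b)}$ is an edge. Given decreasing null sequences $(\mathcal P_n)$, $(\mathcal Q_n)$ and isomorphisms $\nu_n:\operatorname{Gr}(f,\mathcal P_n)\to\operatorname{Gr}(g,\mathcal Q_n)$,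 the sequence $(\nu_n)$ commutes with refinements if $j_n\circ\nu_{n+1}=\nu_n\circ i_n$ for every $n$, where $i_n:\mathcal P_{n+1}\to\mathcal P_n$ and $j_n:\mathcal Q_{n+1}\to\mathcal Q_n$ are the refinement maps. For $a\in\mathcal P_n$ and $m\ge n$ put $$\nu_m(a)=\bigcup\{\nu_m(b): b\in\mathcal P_m,\ b\subset a\},\qquad \tilde\nu_n(a)=\bigcup_{m\ge n}\nu_m(a).$$ The sequence $(\nu_n)$ asymptotically commutes with refinements if $\lim_{n\to\infty}\operatorname{mesh}(\{\tilde\nu_n(a):a\in\mathcal P_n\})=0$. For $(\nu_n^{-1})$ the same definition is used, with $\nu_n^{-1}:\operatorname{Gr}(g,\mathcal Q_n)\to\operatorname{Gr}(f,\mathcal P_n)$ and the roles of $(f,\mathcal P_n)$ and $(g,\mathcal Q_n)$ exchanged. *)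

theory Defs
  imports "HOL-Analysis.Analysis" "Graph_Theory.Pair_Digraph"
begin

text \<open>
  Sequences of points and of partitions are indexed from 0 here, and from 1 in the
  mathematical text: index \<open>n\<close> below is index \<open>n + 1\<close> there. The topology on
  \<open>nat \<Rightarrow> bool\<close> is the product of the discrete topologies, which is the library's type class
  instance for function types. The library's metric on functions is a different one
  (and not available for \<open>bool\<close>), hence \<open>cantor_dist\<close> and \<open>cantor_diameter\<close>.
\<close>

type_synonym cantor = "nat \<Rightarrow> bool"

definition cantor_dist :: "cantor \<Rightarrow> cantor \<Rightarrow> real" where
  "cantor_dist s t = (if s = t then 0 else 1 / real (Suc (LEAST n. s n \<noteq> t n)))"

lemma cantor_dist_less_iff:
  "cantor_dist s t < 1 / real (Suc n) \<longleftrightarrow> (\<forall>i\<le>n. s i = t i)"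
proof (cases "s = t")
  case False
  then have ex: "\<exists>i. s i \<noteq> t i" by auto
  have "cantor_dist s t < 1 / real (Suc n) \<longleftrightarrow> n < (LEAST i. s i \<noteq> t i)"
    using False by (auto simp: cantor_dist_def field_simps)
  also have "\<dots> \<longleftrightarrow> (\<forall>i\<le>n. s i = t i)"
  proof
    assume "n < (LEAST i. s i \<noteq> t i)"
    then show "\<forall>i\<le>n. s i = t i" using not_less_Least le_less_trans by blast
  next
    assume "\<forall>i\<le>n. s i = t i"
    then show "n < (LEAST i. s i \<noteq> t i)" using LeastI_ex[OF ex] not_le by blast
  qed
  finally show ?thesis .
qed (simp add: cantor_dist_def)

lemma Metric_space_cantor_dist: "Metric_space UNIV cantor_dist"
proof
  fix s t u :: cantor
  show "0 \<le> cantor_dist s t" by (simp add: cantor_dist_def)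
  show "cantor_dist s t = cantor_dist t s" by (simp add: cantor_dist_def eq_commute[of s] eq_commute[of "s _"])
  show "cantor_dist s t = 0 \<longleftrightarrow> s = t" by (simp add: cantor_dist_def)
  show "cantor_dist s u \<le> cantor_dist s t + cantor_dist t u"
  proof (cases "s = u")
    case False
    define n where "n = (LEAST i. s i \<noteq> u i)"
    have eq: "cantor_dist s u = 1 / real (Suc n)"
      unfolding cantor_dist_def n_def using False by (rule if_not_P)
    have "\<exists>i. s i \<noteq> u i" using False by auto
    then have "s n \<noteq> u n" unfolding n_def by (rule LeastI_ex)
    then have "\<not> (\<forall>i\<le>n. s i = t i) \<or> \<not> (\<forall>i\<le>n. t i = u i)" by auto
    then have "cantor_dist s t \<ge> 1 / real (Suc n) \<or> cantor_dist t u \<ge> 1 / real (Suc n)"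
      unfolding cantor_dist_less_iff[symmetric] not_less .
    moreover have "cantor_dist s t \<ge> 0" "cantor_dist t u \<ge> 0"
      by (simp_all add: cantor_dist_def)
    ultimately show ?thesis unfolding eq by linarith
  qed (simp add: cantor_dist_def)
qed

lemma open_cantor_iff:
  "open S \<longleftrightarrow> (\<forall>s\<in>S. \<exists>e>0. \<forall>t. cantor_dist s t < e \<longrightarrow> t \<in> S)"
proof safe
  fix s assume S: "open S" and s: "s \<in> S"
  from product_topology_open_contains_basis[OF S[unfolded open_fun_def] s]
  obtain X where X: "s \<in> (\<Pi>\<^sub>E i\<in>UNIV. X i)" "finite {i. X i \<noteq> UNIV}" "(\<Pi>\<^sub>E i\<in>UNIV. X i) \<subseteq> S"
    by auto
  obtain n where n: "\<forall>i\<in>{i. X i \<noteq> UNIV}. i \<le> n"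
    using X(2) finite_nat_set_iff_bounded_le by blast
  have "t \<in> S" if "cantor_dist s t < 1 / real (Suc n)" for t
  proof -
    have "t i \<in> X i" for i
    proof (cases "X i = UNIV")
      case False
      then have "s i = t i" using that n unfolding cantor_dist_less_iff by blast
      moreover have "s i \<in> X i" using X(1) by (rule PiE_mem) simp
      ultimately show ?thesis by (rule subst)
    qed simp
    then have "t \<in> (\<Pi>\<^sub>E i\<in>UNIV. X i)" unfolding PiE_UNIV_domain by blast
    then show ?thesis using X(3) by blast
  qed
  moreover have "1 / real (Suc n) > 0" by simp
  ultimately show "\<exists>e>0. \<forall>t. cantor_dist s t < e \<longrightarrow> t \<in> S" by blast
next
  assume *: "\<forall>s\<in>S. \<exists>e>0. \<forall>t. cantor_dist s t < e \<longrightarrow> t \<in> S"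
  show "open S"
  proof (rule topological_space_class.openI)
    fix s assume "s \<in> S"
    then obtain e where e: "e > 0" "\<And>t. cantor_dist s t < e \<Longrightarrow> t \<in> S" using * by blast
    obtain n where n: "1 / real (Suc n) < e" using nat_approx_posE[OF e(1)] by blast
    define U where "U = {t. \<forall>i\<in>{..n}. t (id i) \<in> {s i}}"
    have "open U" unfolding U_def
      by (rule product_topology_basis') (simp_all add: open_discrete)
    moreover have "s \<in> U" by (simp add: U_def)
    moreover have "U \<subseteq> S"
    proof
      fix t assume "t \<in> U"
      then have "cantor_dist s t < 1 / real (Suc n)"
        unfolding cantor_dist_less_iff by (simp add: U_def)
      then show "t \<in> S" using n by (intro e(2)) linarith
    qed
    ultimately show "\<exists>T. open T \<and> s \<in> T \<and> T \<subseteq> S" by blast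
  qed
qed

definition cantor_diameter :: "cantor set \<Rightarrow> real" where
  "cantor_diameter S = (if S = {} then 0 else SUP (s, t)\<in>S \<times> S. cantor_dist s t)"

definition clopen_partition :: "cantor set set \<Rightarrow> bool" where
  "clopen_partition P \<longleftrightarrow> finite P \<and> partition_on UNIV P \<and> (\<forall>a\<in>P. open a \<and> closed a)"

text \<open>Only meant for finite nonempty collections of nonempty sets.\<close>

definition mesh :: "cantor set set \<Rightarrow> real" where
  "mesh A = Max (cantor_diameter ` A)"

text \<open>The refinement map into \<open>Q\<close>; it does not depend on the refining partition.\<close>

definition refinement_map :: "cantor set set \<Rightarrow> cantor set \<Rightarrow> cantor set" where
  "refinement_map Q a = (THE b. b \<in> Q \<and> a \<subseteq> b)"

definition decreasing_null :: "(nat \<Rightarrow> cantor set set) \<Rightarrow> bool" where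
  "decreasing_null P \<longleftrightarrow> (\<forall>n. clopen_partition (P n)) \<and>
     (\<forall>n. refines UNIV (P (Suc n)) (P n)) \<and> (\<lambda>n. mesh (P n)) \<longlonglongrightarrow> 0"

definition Gr :: "(cantor \<Rightarrow> cantor) \<Rightarrow> cantor set set \<Rightarrow> cantor set pair_pre_digraph" where
  "Gr f P = \<lparr> pverts = P, parcs = {(a, b). a \<in> P \<and> b \<in> P \<and> f ` a \<inter> b \<noteq> {}} \<rparr>"

definition pair_digraph_isomorphism ::
  "('a \<Rightarrow> 'b) \<Rightarrow> 'a pair_pre_digraph \<Rightarrow> 'b pair_pre_digraph \<Rightarrow> bool" where
  "pair_digraph_isomorphism \<nu> G H \<longleftrightarrow> bij_betw \<nu> (pverts G) (pverts H) \<and>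
     (\<forall>a\<in>pverts G. \<forall>b\<in>pverts G. (a, b) \<in> parcs G \<longleftrightarrow> (\<nu> a, \<nu> b) \<in> parcs H)"

definition commutes_with_refinements ::
  "(nat \<Rightarrow> cantor set set) \<Rightarrow> (nat \<Rightarrow> cantor set set) \<Rightarrow>
   (nat \<Rightarrow> cantor set \<Rightarrow> cantor set) \<Rightarrow> bool" where
  "commutes_with_refinements P Q \<nu> \<longleftrightarrow>
     (\<forall>n. \<forall>a\<in>P (Suc n). refinement_map (Q n) (\<nu> (Suc n) a) = \<nu> n (refinement_map (P n) a))"

text \<open>
  \<open>extend_iso P \<nu> m a\<close> is \<open>\<nu>\<^sub>m(a)\<close> for \<open>a \<in> P\<^sub>n\<close> with \<open>m \<ge> n\<close>,
  and \<open>tilde_iso P \<nu> n a\<close> is the union of these sets over all such \<open>m\<close>.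
\<close>

definition extend_iso ::
  "(nat \<Rightarrow> cantor set set) \<Rightarrow> (nat \<Rightarrow> cantor set \<Rightarrow> cantor set) \<Rightarrow> nat \<Rightarrow> cantor set \<Rightarrow> cantor set"
  where "extend_iso P \<nu> m a = \<Union> {\<nu> m b | b. b \<in> P m \<and> b \<subseteq> a}"

definition tilde_iso ::
  "(nat \<Rightarrow> cantor set set) \<Rightarrow> (nat \<Rightarrow> cantor set \<Rightarrow> cantor set) \<Rightarrow> nat \<Rightarrow> cantor set \<Rightarrow> cantor set"
  where "tilde_iso P \<nu> n a = (\<Union>m\<in>{n..}. extend_iso P \<nu> m a)"

definition asymptotically_commutes_with_refinements ::
  "(nat \<Rightarrow> cantor set set) \<Rightarrow> (nat \<Rightarrow> cantor set \<Rightarrow> cantor set) \<Rightarrow> bool" where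
  "asymptotically_commutes_with_refinements P \<nu> \<longleftrightarrow>
     (\<lambda>n. mesh (tilde_iso P \<nu> n ` P n)) \<longlonglongrightarrow> 0"

definition conjugates :: "(cantor \<Rightarrow> cantor) \<Rightarrow> (cantor \<Rightarrow> cantor) \<Rightarrow> bool" where
  "conjugates f g \<longleftrightarrow> (\<exists>h h'. homeomorphism UNIV UNIV h h' \<and> f = h' \<circ> g \<circ> h)"

end

theory Submission
  imports Defs
begin

text \<open>
  A conjugacy \<open>h\<close> carries a decreasing null sequence of partitions to another one, and
  \<open>a \<mapsto> h(a)\<close> is then an isomorphism of the associated digraphs which respects inclusion.
  Uniform continuity of \<open>h\<close> makes the meshes of the images small, so any decreasing null
  sequence, such as that of the cylinder partitions, yields (ii); see
  \<open>conjugates_imp_commuting\<close>. If \<open>\<nu>\<close> commutes with refinements then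
  \<open>\<nu>\<^sub>m(b) \<subseteq> \<nu>\<^sub>n(a)\<close> whenever \<open>b \<subseteq> a\<close> and \<open>m \<ge> n\<close>, so the
  set \<open>tilde-\<nu>\<^sub>n(a)\<close> of the asymptotic condition lies in \<open>\<nu>\<^sub>n(a)\<close>, whose diameter
  tends to 0. Commutation passes to the inverses, and (iii) follows; see
  \<open>commuting_imp_asymptotically_commuting\<close>.

  The substance is in (iii) implies (i). Let \<open>a\<^sub>n(x)\<close> be the member of \<open>P\<^sub>n\<close> that contains
  \<open>x\<close>. Since \<open>a\<^sub>m(x) \<subseteq> a\<^sub>n(x)\<close> for \<open>m \<ge> n\<close>, all the sets \<open>\<nu>\<^sub>m(a\<^sub>m(x))\<close> with
  \<open>m \<ge> n\<close> lie in the one small set \<open>tilde-\<nu>\<^sub>n(a\<^sub>n(x))\<close>. So they shrink to a point \<open>h(x)\<close>,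
  and every choice of points \<open>z\<^sub>n \<in> \<nu>\<^sub>n(a\<^sub>n(x))\<close> converges to it
  (\<open>tendsto_limit_map\<close>). Three things remain.

  \<^item> Continuity: \<open>h\<close> maps the open set \<open>a\<^sub>n(x)\<close> into the closure of
  \<open>tilde-\<nu>\<^sub>n(a\<^sub>n(x))\<close>, which is small.

  \<^item> Bijectivity: the inverses \<open>\<nu>\<^sub>n\<^sup>-\<^sup>1\<close> give a map \<open>h'\<close> in the same way. A member
  \<open>b\<close> of \<open>Q\<^sub>n\<close> with \<open>h(x) \<in> b\<close> is open, hence meets and, by
  refinement, contains \<open>\<nu>\<^sub>m(a\<^sub>m(x))\<close> for some
  \<open>m \<ge> n\<close>; applying \<open>\<nu>\<^sub>m\<^sup>-\<^sup>1\<close> puts \<open>x\<close> into the small set attached to \<open>b\<close>, to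
  whose closure \<open>h'(h(x))\<close> belongs (\<open>limit_map_inverse\<close>).

  \<^item> Conjugacy: there is an edge from \<open>a\<^sub>n(x)\<close> to \<open>a\<^sub>n(f(x))\<close>, so its image is an edge of
  \<open>Gr(g, Q\<^sub>n)\<close>, which provides \<open>z\<^sub>n \<in> \<nu>\<^sub>n(a\<^sub>n(x))\<close> with
  \<open>g(z\<^sub>n) \<in> \<nu>\<^sub>n(a\<^sub>n(f(x)))\<close>. In the limit, \<open>g(h(x)) = h(f(x))\<close>.

  The metric takes only the values 0 and \<open>1 / (k + 1)\<close>, so metric statements are turned into
  statements on the agreement of sequences up to an index. The relation \<open>agree k\<close> is an
  equivalence relation, which replaces the triangle inequality and all adding up of epsilons.
\<close>

section \<open>The topology of Cantor space through agreement of sequences\<close>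

text \<open>
  Equivalently, the distance of \<open>s\<close> and \<open>t\<close> is less than \<open>1 / (k + 1)\<close>.
\<close>

definition agree :: "nat \<Rightarrow> cantor \<Rightarrow> cantor \<Rightarrow> bool" where
  "agree k s t \<longleftrightarrow> (\<forall>i\<le>k. s i = t i)"

definition small :: "nat \<Rightarrow> cantor set \<Rightarrow> bool" where
  "small k S \<longleftrightarrow> (\<forall>s\<in>S. \<forall>t\<in>S. agree k s t)"

definition cylinder :: "nat \<Rightarrow> cantor \<Rightarrow> cantor set" where
  "cylinder k s = {t. agree k s t}"

lemma agree_refl [simp]: "agree k s s"
  by (simp add: agree_def)

lemma agree_sym: "agree k s t \<Longrightarrow> agree k t s"
  by (simp add: agree_def)

lemma agree_trans: "agree k s t \<Longrightarrow> agree k t u \<Longrightarrow> agree k s u"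
  by (simp add: agree_def)

lemma agree_mono: "agree m s t \<Longrightarrow> k \<le> m \<Longrightarrow> agree k s t"
  by (simp add: agree_def)

lemma agree_all_eq: "(\<And>k. agree k s t) \<Longrightarrow> s = t"
  unfolding agree_def by blast

lemma small_subset: "small k T \<Longrightarrow> S \<subseteq> T \<Longrightarrow> small k S"
  unfolding small_def by blast

lemma open_iff_agree: "open S \<longleftrightarrow> (\<forall>s\<in>S. \<exists>k. \<forall>t. agree k s t \<longrightarrow> t \<in> S)"
proof -
  have "(\<exists>e>0. \<forall>t. cantor_dist s t < e \<longrightarrow> t \<in> S) \<longleftrightarrow> (\<exists>k. \<forall>t. agree k s t \<longrightarrow> t \<in> S)" for s
  proof
    assume "\<exists>e>0. \<forall>t. cantor_dist s t < e \<longrightarrow> t \<in> S"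
    then obtain e where e: "e > 0" "\<And>t. cantor_dist s t < e \<Longrightarrow> t \<in> S" by blast
    obtain k where "1 / real (Suc k) < e" using nat_approx_posE[OF e(1)] by blast
    then show "\<exists>k. \<forall>t. agree k s t \<longrightarrow> t \<in> S"
      using e(2) unfolding agree_def cantor_dist_less_iff[symmetric] by (meson less_trans)
  next
    assume "\<exists>k. \<forall>t. agree k s t \<longrightarrow> t \<in> S"
    then obtain k where k: "\<forall>t. agree k s t \<longrightarrow> t \<in> S" ..
    have "1 / real (Suc k) > 0" by simp
    then show "\<exists>e>0. \<forall>t. cantor_dist s t < e \<longrightarrow> t \<in> S"
      using k unfolding agree_def cantor_dist_less_iff[symmetric] by blast
  qed
  then show ?thesis unfolding open_cantor_iff by simp
qed

lemma open_cylinder: "open (cylinder k s)"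
  unfolding open_iff_agree cylinder_def using agree_trans by blast

lemma closed_cylinder: "closed (cylinder k s)"
  unfolding closed_def open_iff_agree cylinder_def using agree_trans agree_sym by blast

lemma continuous_iff_agree:
  "continuous_on UNIV h \<longleftrightarrow> (\<forall>s k. \<exists>m. \<forall>t. agree m s t \<longrightarrow> agree k (h s) (h t))"
proof
  assume h: "continuous_on UNIV h"
  show "\<forall>s k. \<exists>m. \<forall>t. agree m s t \<longrightarrow> agree k (h s) (h t)"
  proof (intro allI)
    fix s k
    have "open (h -` cylinder k (h s))"
      using h open_cylinder by (simp add: open_vimage)
    moreover have "s \<in> h -` cylinder k (h s)" by (simp add: cylinder_def)
    ultimately show "\<exists>m. \<forall>t. agree m s t \<longrightarrow> agree k (h s) (h t)"
      unfolding open_iff_agree by (fastforce simp: cylinder_def)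
  qed
next
  assume *: "\<forall>s k. \<exists>m. \<forall>t. agree m s t \<longrightarrow> agree k (h s) (h t)"
  have "open (h -` S)" if "open S" for S
    using that * unfolding open_iff_agree by (meson vimage_eq)
  then show "continuous_on UNIV h"
    by (simp add: continuous_on_open_vimage)
qed

text \<open>
  Tychonoff's theorem; the type class topology on functions is the abstract product topology.
\<close>

lemma compact_UNIV_cantor: "compact (UNIV :: cantor set)"
proof -
  have "compact_space (product_topology (\<lambda>i::nat. euclidean :: bool topology) UNIV)"
    unfolding compact_space_product_topology
    by (simp add: compact_space_def finite_imp_compact)
  then show ?thesis
    by (simp add: euclidean_product_topology compact_space_def)
qed

text \<open>
  A Lebesgue number argument: agreement up to the largest of finitely many indices suffices,
  as two sequences in agreement up to that index lie in a common cylinder of the subcover.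
\<close>

lemma uniformly_continuous_agree:
  assumes "continuous_on UNIV h"
  shows "\<exists>m. \<forall>s t. agree m s t \<longrightarrow> agree k (h s) (h t)"
proof -
  obtain N where N: "\<And>s t. agree (N s) s t \<Longrightarrow> agree k (h s) (h t)"
    using assms[unfolded continuous_iff_agree, rule_format, of _ k] by metis
  have "UNIV \<subseteq> (\<Union>s. cylinder (N s) s)" by (auto simp: cylinder_def)
  then obtain C where C: "finite C" "UNIV \<subseteq> (\<Union>s\<in>C. cylinder (N s) s)"
    using compactE_image[OF compact_UNIV_cantor, of UNIV "\<lambda>s. cylinder (N s) s"] open_cylinder
    by metis
  have "agree k (h s) (h t)" if "agree (Max (N ` C)) s t" for s t
  proof -
    obtain c where c: "c \<in> C" "agree (N c) c s" using C(2) by (auto simp: cylinder_def)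
    have "agree (N c) s t" using that C(1) c(1) by (auto intro: agree_mono)
    with c(2) have "agree (N c) c t" by (rule agree_trans)
    then show ?thesis using N c(2) agree_sym agree_trans by meson
  qed
  then show ?thesis by blast
qed

lemma tendsto_iff_agree:
  "s \<longlonglongrightarrow> y \<longleftrightarrow> (\<forall>k. \<forall>\<^sub>F n in sequentially. agree k (s n) y)"
proof
  assume s: "s \<longlonglongrightarrow> y"
  show "\<forall>k. \<forall>\<^sub>F n in sequentially. agree k (s n) y"
  proof
    fix k
    have "\<forall>\<^sub>F n in sequentially. s n \<in> cylinder k y"
      using s open_cylinder by (rule topological_tendstoD) (simp add: cylinder_def)
    then show "\<forall>\<^sub>F n in sequentially. agree k (s n) y"
      by eventually_elim (simp add: cylinder_def agree_sym)
  qed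
next
  assume *: "\<forall>k. \<forall>\<^sub>F n in sequentially. agree k (s n) y"
  show "s \<longlonglongrightarrow> y"
  proof (rule topological_tendstoI)
    fix S :: "cantor set" assume "open S" "y \<in> S"
    then obtain k where k: "\<And>t. agree k y t \<Longrightarrow> t \<in> S" unfolding open_iff_agree by blast
    from * have "\<forall>\<^sub>F n in sequentially. agree k (s n) y" ..
    then show "\<forall>\<^sub>F n in sequentially. s n \<in> S"
      by eventually_elim (simp add: k agree_sym)
  qed
qed

lemma cantor_LIMSEQ_unique:
  fixes y z :: cantor
  assumes "s \<longlonglongrightarrow> y" "s \<longlonglongrightarrow> z"
  shows "y = z"
proof (rule agree_all_eq)
  fix k
  have "\<forall>\<^sub>F n in sequentially. agree k y z"
    using assms(1)[unfolded tendsto_iff_agree, rule_format, of k]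
      assms(2)[unfolded tendsto_iff_agree, rule_format, of k]
    by eventually_elim (simp add: agree_def)
  then show "agree k y z" by simp
qed

text \<open>
  Completeness: entry \<open>i\<close> of a Cauchy sequence is eventually constant, and the constants
  form the limit.
\<close>

lemma agree_Cauchy_convergent:
  assumes "\<And>k. \<exists>N. \<forall>n\<ge>N. agree k (s n) (s N)"
  shows "\<exists>y. s \<longlonglongrightarrow> y"
proof -
  obtain N where N: "\<And>k n. n \<ge> N k \<Longrightarrow> agree k (s n) (s (N k))" using assms by metis
  define y where "y i = s (N i) i" for i
  have "agree k (s n) y" if n: "n \<ge> Max (N ` {..k})" for n k
    unfolding agree_def
  proof (intro allI impI)
    fix i assume "i \<le> k"
    with n have "N i \<le> n" by (auto dest: Max.boundedE)
    then have "agree i (s n) (s (N i))" by (rule N)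
    then show "s n i = y i" by (simp add: agree_def y_def)
  qed
  then have "s \<longlonglongrightarrow> y"
    unfolding tendsto_iff_agree eventually_sequentially by blast
  then show ?thesis by (rule exI[where x = y])
qed

section \<open>Diameter and mesh\<close>

lemma bdd_above_cantor_dist: "bdd_above ((\<lambda>(s, t). cantor_dist s t) ` A)"
  by (intro bdd_aboveI[where M = 1]) (auto simp: cantor_dist_def)

text \<open>
  The distances that occur are \<open>0\<close> and the numbers \<open>1 / (i + 1)\<close>. Being below
  \<open>1 / (k + 1)\<close> is therefore the same as being at most \<open>1 / (k + 2)\<close>, and this bound
  passes to the supremum without the strict inequality being lost.
\<close>

lemma cantor_diameter_less_iff:
  "cantor_diameter S < 1 / real (Suc k) \<longleftrightarrow> small k S"
proof (cases "S = {}")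
  case False
  define D where "D = (\<lambda>(s, t). cantor_dist s t) ` (S \<times> S)"
  have ne: "D \<noteq> {}" using False by (auto simp: D_def)
  have bdd: "bdd_above D" unfolding D_def by (rule bdd_above_cantor_dist)
  have diam: "cantor_diameter S = Sup D" using False by (simp add: cantor_diameter_def D_def)
  show ?thesis
  proof
    assume less: "cantor_diameter S < 1 / real (Suc k)"
    show "small k S" unfolding small_def
    proof safe
      fix s t assume "s \<in> S" "t \<in> S"
      then have "cantor_dist s t \<in> D" unfolding D_def by (intro image_eqI[where x = "(s, t)"]) auto
      then have "cantor_dist s t \<le> Sup D" using bdd by (rule cSup_upper)
      then show "agree k s t"
        using less unfolding diam agree_def cantor_dist_less_iff[symmetric] by linarith
    qed
  next
    assume small: "small k S"
    have "d \<le> 1 / real (Suc (Suc k))" if d: "d \<in> D" for d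
    proof -
      obtain s t where st: "s \<in> S" "t \<in> S" "d = cantor_dist s t" using d by (auto simp: D_def)
      then have ag: "agree k s t" using small by (simp add: small_def)
      show ?thesis
      proof (cases "s = t")
        case False
        define n where "n = (LEAST i. s i \<noteq> t i)"
        from False have "\<exists>i. s i \<noteq> t i" by auto
        then have "s n \<noteq> t n" unfolding n_def by (rule LeastI_ex)
        with ag have "\<not> n \<le> k" unfolding agree_def by blast
        moreover have "d = 1 / real (Suc n)"
          unfolding st(3) n_def cantor_dist_def by (rule if_not_P[OF False])
        ultimately show ?thesis by (simp add: frac_le)
      qed (simp add: st(3) cantor_dist_def)
    qed
    then have "Sup D \<le> 1 / real (Suc (Suc k))" using ne by (intro cSup_least)
    also have "\<dots> < 1 / real (Suc k)" by (simp add: frac_less2)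
    finally show "cantor_diameter S < 1 / real (Suc k)" by (simp add: diam)
  qed
qed (simp add: cantor_diameter_def small_def)

lemma cantor_diameter_nonneg: "cantor_diameter S \<ge> 0"
proof (cases "S = {}")
  case False
  then obtain s where s: "s \<in> S" by blast
  have "0 \<in> (\<lambda>(s, t). cantor_dist s t) ` (S \<times> S)"
    using s by (intro image_eqI[where x = "(s, s)"]) (auto simp: cantor_dist_def)
  then have "0 \<le> Sup ((\<lambda>(s, t). cantor_dist s t) ` (S \<times> S))"
    using bdd_above_cantor_dist by (rule cSup_upper)
  then show ?thesis using False by (simp add: cantor_diameter_def)
qed (simp add: cantor_diameter_def)

lemma mesh_tendsto_0_iff:
  assumes "\<And>n. finite (A n)" "\<And>n. A n \<noteq> {}"
  shows "(\<lambda>n. mesh (A n)) \<longlonglongrightarrow> 0 \<longleftrightarrow> (\<forall>k. \<forall>\<^sub>F n in sequentially. \<forall>a\<in>A n. small k a)"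
proof -
  have less: "mesh (A n) < 1 / real (Suc k) \<longleftrightarrow> (\<forall>a\<in>A n. small k a)" for n k
    using assms unfolding mesh_def by (simp add: cantor_diameter_less_iff del: of_nat_Suc)
  have nonneg: "mesh (A n) \<ge> 0" for n
  proof -
    obtain a where "a \<in> A n" using assms(2) by blast
    then have "cantor_diameter a \<le> mesh (A n)" unfolding mesh_def using assms(1) by simp
    then show ?thesis using cantor_diameter_nonneg order_trans by blast
  qed
  show ?thesis
  proof
    assume lim: "(\<lambda>n. mesh (A n)) \<longlonglongrightarrow> 0"
    show "\<forall>k. \<forall>\<^sub>F n in sequentially. \<forall>a\<in>A n. small k a"
      unfolding less[symmetric] using order_tendstoD(2)[OF lim] by simp
  next
    assume *: "\<forall>k. \<forall>\<^sub>F n in sequentially. \<forall>a\<in>A n. small k a"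
    show "(\<lambda>n. mesh (A n)) \<longlonglongrightarrow> 0"
    proof (rule order_tendstoI)
      fix e :: real assume "e < 0"
      then show "\<forall>\<^sub>F n in sequentially. mesh (A n) > e"
        using nonneg by (intro always_eventually allI) (rule less_le_trans)
    next
      fix e :: real assume "e > 0"
      then obtain k where k: "1 / real (Suc k) < e" using nat_approx_posE by blast
      from * have "\<forall>\<^sub>F n in sequentially. \<forall>a\<in>A n. small k a" ..
      then show "\<forall>\<^sub>F n in sequentially. mesh (A n) < e"
        unfolding less[symmetric] by eventually_elim (use k in linarith)
    qed
  qed
qed

section \<open>Partitions and refinement\<close>

lemma partition_unique:
  assumes "clopen_partition P" "a \<in> P" "b \<in> P" "x \<in> a" "x \<in> b"
  shows "a = b"
  using assms unfolding clopen_partition_def partition_on_def disjoint_def by blast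

lemma partition_nonempty: "clopen_partition P \<Longrightarrow> a \<in> P \<Longrightarrow> a \<noteq> {}"
  unfolding clopen_partition_def partition_on_def by blast

lemma partition_finite: "clopen_partition P \<Longrightarrow> finite P \<and> P \<noteq> {}"
  unfolding clopen_partition_def partition_on_def by blast

definition cell :: "cantor set set \<Rightarrow> cantor \<Rightarrow> cantor set" where
  "cell P x = (THE a. a \<in> P \<and> x \<in> a)"

lemma cell_in:
  assumes "clopen_partition P"
  shows "cell P x \<in> P" "x \<in> cell P x"
proof -
  obtain a where a: "a \<in> P \<and> x \<in> a"
    using assms unfolding clopen_partition_def partition_on_def by blast
  then have "cell P x \<in> P \<and> x \<in> cell P x"
    unfolding cell_def by (rule theI) (use a partition_unique[OF assms] in blast)
  then show "cell P x \<in> P" "x \<in> cell P x" by auto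
qed

lemma cell_eq: "clopen_partition P \<Longrightarrow> a \<in> P \<Longrightarrow> x \<in> a \<Longrightarrow> cell P x = a"
  using cell_in partition_unique by blast

lemma refinement_map_eq:
  assumes "clopen_partition Q" "b \<in> Q" "a \<subseteq> b" "a \<noteq> {}"
  shows "refinement_map Q a = b"
  unfolding refinement_map_def
proof (rule the_equality)
  fix c assume "c \<in> Q \<and> a \<subseteq> c"
  then show "c = b" using assms partition_unique[OF assms(1), of c b] by blast
qed (use assms in simp)

lemma decreasing_null_partition: "decreasing_null P \<Longrightarrow> clopen_partition (P n)"
  by (simp add: decreasing_null_def)

lemma decreasing_null_small:
  assumes "decreasing_null P"
  shows "\<forall>\<^sub>F n in sequentially. \<forall>a\<in>P n. small k a"
  using assms mesh_tendsto_0_iff[of P] partition_finite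
  unfolding decreasing_null_def by blast

lemma decreasing_null_subset:
  assumes P: "decreasing_null P" and "n \<le> m" "a \<in> P m" "b \<in> P n" "x \<in> a" "x \<in> b"
  shows "a \<subseteq> b"
proof -
  have "\<exists>b\<in>P n. a \<subseteq> b" if "a \<in> P m" for a
    using \<open>n \<le> m\<close> that
  proof (induction m arbitrary: a rule: dec_induct)
    case (step m)
    then obtain c where "c \<in> P m" "a \<subseteq> c"
      using P unfolding decreasing_null_def refines_def by meson
    then show ?case using step.IH by (meson order_trans)
  qed blast
  then obtain b' where b': "b' \<in> P n" "a \<subseteq> b'" using assms(3) by blast
  then have "b' = b"
    using partition_unique[OF decreasing_null_partition[OF P]] assms by blast
  then show ?thesis using b' by simp
qed

lemma refinement_map_in:
  assumes "decreasing_null P" "a \<in> P (Suc n)"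
  shows "refinement_map (P n) a \<in> P n" "a \<subseteq> refinement_map (P n) a"
proof -
  obtain b where b: "b \<in> P n" "a \<subseteq> b"
    using assms unfolding decreasing_null_def refines_def by meson
  then have "refinement_map (P n) a = b"
    using refinement_map_eq[OF decreasing_null_partition[OF assms(1)] b]
      partition_nonempty[OF decreasing_null_partition[OF assms(1)] assms(2)] by simp
  then show "refinement_map (P n) a \<in> P n" "a \<subseteq> refinement_map (P n) a" using b by auto
qed

section \<open>Commuting and asymptotically commuting isomorphisms\<close>

text \<open>
  Commutation with the refinement maps is monotonicity between consecutive levels. The members
  of a partition being disjoint and nonempty, an inclusion determines the larger member, so the
  equation of refinement maps carries no more information than the inclusion.
\<close>

lemma commutes_with_refinements_iff:
  assumes "decreasing_null P" "decreasing_null Q" "\<And>n. bij_betw (\<nu> n) (P n) (Q n)"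
  shows "commutes_with_refinements P Q \<nu> \<longleftrightarrow>
    (\<forall>n. \<forall>a\<in>P (Suc n). \<forall>b\<in>P n. a \<subseteq> b \<longrightarrow> \<nu> (Suc n) a \<subseteq> \<nu> n b)"
proof -
  have "refinement_map (Q n) (\<nu> (Suc n) a) = \<nu> n (refinement_map (P n) a) \<longleftrightarrow>
        (\<forall>b\<in>P n. a \<subseteq> b \<longrightarrow> \<nu> (Suc n) a \<subseteq> \<nu> n b)" if a: "a \<in> P (Suc n)" for n a
  proof -
    note c = refinement_map_in[OF assms(1) a]
    have *: "refinement_map (P n) a = b" if "b \<in> P n" "a \<subseteq> b" for b
      using refinement_map_eq[OF decreasing_null_partition[OF assms(1)] that]
        partition_nonempty[OF decreasing_null_partition[OF assms(1)] a] by simp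
    have \<nu>a: "\<nu> (Suc n) a \<in> Q (Suc n)" using a assms(3) bij_betwE by metis
    have \<nu>c: "\<nu> n (refinement_map (P n) a) \<in> Q n" using c assms(3) bij_betwE by metis
    have "refinement_map (Q n) (\<nu> (Suc n) a) = \<nu> n (refinement_map (P n) a) \<longleftrightarrow>
          \<nu> (Suc n) a \<subseteq> \<nu> n (refinement_map (P n) a)"
    proof
      assume "\<nu> (Suc n) a \<subseteq> \<nu> n (refinement_map (P n) a)"
      then show "refinement_map (Q n) (\<nu> (Suc n) a) = \<nu> n (refinement_map (P n) a)"
        using refinement_map_eq[OF decreasing_null_partition[OF assms(2)] \<nu>c]
          partition_nonempty[OF decreasing_null_partition[OF assms(2)] \<nu>a] by blast
    qed (use refinement_map_in(2)[OF assms(2) \<nu>a] in simp)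
    also have "\<dots> \<longleftrightarrow> (\<forall>b\<in>P n. a \<subseteq> b \<longrightarrow> \<nu> (Suc n) a \<subseteq> \<nu> n b)"
    proof (intro iffI ballI impI)
      fix b assume "\<nu> (Suc n) a \<subseteq> \<nu> n (refinement_map (P n) a)" "b \<in> P n" "a \<subseteq> b"
      then show "\<nu> (Suc n) a \<subseteq> \<nu> n b" using * by simp
    qed (use c in simp)
    finally show ?thesis .
  qed
  then show ?thesis unfolding commutes_with_refinements_def by simp
qed

lemma commutes_with_refinements_inverse:
  assumes "decreasing_null P" "decreasing_null Q" "\<And>n. bij_betw (\<nu> n) (P n) (Q n)"
    "commutes_with_refinements P Q \<nu>"
  shows "commutes_with_refinements Q P (\<lambda>n. inv_into (P n) (\<nu> n))"
  unfolding commutes_with_refinements_def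
proof (intro allI ballI)
  fix n c assume c: "c \<in> Q (Suc n)"
  define a where "a = inv_into (P (Suc n)) (\<nu> (Suc n)) c"
  have a: "a \<in> P (Suc n)" "\<nu> (Suc n) a = c"
    unfolding a_def using c assms(3)[of "Suc n"] inv_into_into[of c "\<nu> (Suc n)" "P (Suc n)"]
    by (auto simp: bij_betw_def f_inv_into_f)
  have "refinement_map (Q n) c = \<nu> n (refinement_map (P n) a)"
    using assms(4) a unfolding commutes_with_refinements_def by metis
  then have "inv_into (P n) (\<nu> n) (refinement_map (Q n) c) = refinement_map (P n) a"
    using assms(3) refinement_map_in(1)[OF assms(1) a(1)] by (metis bij_betw_inv_into_left)
  then show "refinement_map (P n) (inv_into (P (Suc n)) (\<nu> (Suc n)) c) =
    inv_into (P n) (\<nu> n) (refinement_map (Q n) c)"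
    by (simp add: a_def)
qed

lemma asymptotically_commutes_iff:
  assumes "decreasing_null P"
  shows "asymptotically_commutes_with_refinements P \<nu> \<longleftrightarrow>
    (\<forall>k. \<forall>\<^sub>F n in sequentially. \<forall>a\<in>P n. small k (tilde_iso P \<nu> n a))"
proof -
  have "finite (tilde_iso P \<nu> n ` P n)" "tilde_iso P \<nu> n ` P n \<noteq> {}" for n
    using partition_finite decreasing_null_partition[OF assms] by auto
  then show ?thesis
    unfolding asymptotically_commutes_with_refinements_def by (subst mesh_tendsto_0_iff) auto
qed

text \<open>
  By induction on \<open>m\<close>, monotonicity between consecutive levels extends to
  \<open>\<nu>\<^sub>m(a) \<subseteq> \<nu>\<^sub>n(b)\<close> for \<open>a \<subseteq> b\<close> and \<open>m \<ge> n\<close>. So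
  the sets whose mesh is in question are contained in members of \<open>Q\<^sub>n\<close>.
\<close>

lemma commutes_imp_asymptotically_commutes:
  assumes P: "decreasing_null P" and Q: "decreasing_null Q"
    and bij: "\<And>n. bij_betw (\<nu> n) (P n) (Q n)" and "commutes_with_refinements P Q \<nu>"
  shows "asymptotically_commutes_with_refinements P \<nu>"
proof -
  have sub: "\<nu> m a \<subseteq> \<nu> n b" if "n \<le> m" "a \<in> P m" "b \<in> P n" "a \<subseteq> b" for n m a b
    using that
  proof (induction m arbitrary: a rule: dec_induct)
    case base
    obtain x where "x \<in> a" 
      using base partition_nonempty[OF decreasing_null_partition[OF P]] by blast
    then have "a = b" using base partition_unique[OF decreasing_null_partition[OF P]] by blast
    then show ?case by simp
  next
    case (step m)
    define c where "c = refinement_map (P m) a"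
    have c: "c \<in> P m" "a \<subseteq> c" unfolding c_def using refinement_map_in[OF P] step.prems by blast+
    obtain x where "x \<in> a"
      using step.prems partition_nonempty[OF decreasing_null_partition[OF P]] by blast
    then have "c \<subseteq> b" using decreasing_null_subset[OF P \<open>n \<le> m\<close>] c step.prems by blast
    then have "\<nu> m c \<subseteq> \<nu> n b" using step.IH c step.prems by blast
    moreover have "\<nu> (Suc m) a \<subseteq> \<nu> m c" using assms(4) c step.prems 
      unfolding commutes_with_refinements_iff[OF P Q bij] by blast
    ultimately show ?case by blast
  qed
  have "tilde_iso P \<nu> n b \<subseteq> \<nu> n b" if "b \<in> P n" for n b
    unfolding tilde_iso_def extend_iso_def using sub[OF _ _ that] by blast
  moreover have "\<nu> n b \<in> Q n" if "b \<in> P n" for n b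
    using that bij bij_betwE by metis
  ultimately have "\<forall>a\<in>P n. small k (tilde_iso P \<nu> n a)" if "\<forall>c\<in>Q n. small k c" for n k
    using that small_subset by blast
  then show ?thesis
    unfolding asymptotically_commutes_iff[OF P]
    by (intro allI eventually_mono[OF decreasing_null_small[OF Q]])
qed

lemma commuting_imp_asymptotically_commuting:
  assumes P: "decreasing_null P" and Q: "decreasing_null Q"
    and iso: "\<And>n. pair_digraph_isomorphism (\<nu> n) (Gr f (P n)) (Gr g (Q n))"
    and comm: "commutes_with_refinements P Q \<nu>"
  shows "asymptotically_commutes_with_refinements P \<nu>"
    "asymptotically_commutes_with_refinements Q (\<lambda>n. inv_into (P n) (\<nu> n))"
proof -
  have bij: "bij_betw (\<nu> n) (P n) (Q n)" for n
    using iso[of n] by (simp add: pair_digraph_isomorphism_def Gr_def)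
  show "asymptotically_commutes_with_refinements P \<nu>"
    using P Q bij comm by (rule commutes_imp_asymptotically_commutes)
  show "asymptotically_commutes_with_refinements Q (\<lambda>n. inv_into (P n) (\<nu> n))"
    using Q P bij_betw_inv_into[OF bij] commutes_with_refinements_inverse[OF P Q bij comm]
    by (rule commutes_imp_asymptotically_commutes)
qed

section \<open>From a conjugacy to commuting isomorphisms\<close>

lemma cylinder_partition_decreasing_null: "decreasing_null (\<lambda>n. range (cylinder n))"
proof -
  have part: "partition_on UNIV (range (cylinder n))" for n
  proof (rule partition_onI)
    have self: "s \<in> cylinder n s" for s by (simp add: cylinder_def)
    then show "\<Union> (range (cylinder n)) = UNIV" by blast
    show "{} \<notin> range (cylinder n)" using self by blast
  next
    fix p q assume "p \<in> range (cylinder n)" "q \<in> range (cylinder n)" "p \<noteq> q"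
    then obtain s t where st: "p = cylinder n s" "q = cylinder n t" by blast
    have "p = q" if "x \<in> p" "x \<in> q" for x
      using that unfolding st cylinder_def agree_def by simp
    then show "disjnt p q" using \<open>p \<noteq> q\<close> by (auto simp: disjnt_iff)
  qed
  have fin: "finite (range (cylinder n))" for n
  proof -
    \<comment> \<open>a cylinder is determined by the set of indices up to \<open>n\<close> with entry true\<close>
    have "cylinder n s = cylinder n (\<lambda>i. i \<in> {i. i \<le> n \<and> s i})" for s
      by (auto simp: cylinder_def agree_def)
    then have "range (cylinder n) \<subseteq> (\<lambda>A. cylinder n (\<lambda>i. i \<in> A)) ` Pow {..n}" by blast
    then show ?thesis by (rule finite_subset) simp
  qed
  have clopen: "clopen_partition (range (cylinder n))" for n
    unfolding clopen_partition_def using part fin open_cylinder closed_cylinder by blast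
  have "refines UNIV (range (cylinder (Suc n))) (range (cylinder n))" for n
  proof -
    have "cylinder (Suc n) s \<subseteq> cylinder n s" for s
      by (auto simp: cylinder_def intro: agree_mono)
    then show ?thesis unfolding refines_def using part by blast
  qed
  moreover have "(\<lambda>n. mesh (range (cylinder n))) \<longlonglongrightarrow> 0"
  proof (rule mesh_tendsto_0_iff[THEN iffD2])
    have "\<forall>a\<in>range (cylinder n). small k a" if "n \<ge> k" for n k
      using that by (auto simp: small_def cylinder_def agree_def)
    then show "\<forall>k. \<forall>\<^sub>F n in sequentially. \<forall>a\<in>range (cylinder n). small k a"
      unfolding eventually_sequentially by blast
  qed (use fin in auto)
  ultimately show ?thesis unfolding decreasing_null_def using clopen by blast
qed

text \<open>
  Only the mesh needs an argument: \<open>h\<close> is uniformly continuous, so sufficiently small members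
  of \<open>P\<^sub>n\<close> have small images.
\<close>

lemma homeomorphism_image_decreasing_null:
  assumes h: "homeomorphism UNIV UNIV h h'" and P: "decreasing_null P"
  shows "decreasing_null (\<lambda>n. (`) h ` P n)"
proof -
  have cont: "continuous_on UNIV h" "continuous_on UNIV h'"
    and h'h: "\<And>x. h' (h x) = x" and hh': "\<And>x. h (h' x) = x"
    using h by (auto simp: homeomorphism_def)
  have inj: "inj h" using h'h by (metis injI)
  have surj: "range h = UNIV" using hh' by (metis surjI)
  have vim: "h ` a = h' -` a" for a
  proof (intro set_eqI iffI)
    fix y assume "y \<in> h' -` a"
    then have "h (h' y) \<in> h ` a" by (intro imageI) simp
    then show "y \<in> h ` a" by (simp add: hh')
  qed (auto simp: h'h)
  have part: "partition_on UNIV ((`) h ` P n)" for n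
  proof -
    have "partition_on UNIV (P n)"
      using decreasing_null_partition[OF P] unfolding clopen_partition_def by blast
    then have "partition_on (range h) ((`) h ` P n - {{}})" "{} \<notin> P n"
      using inj by (auto intro: partition_on_inj_image dest: partition_onD3)
    moreover have "(`) h ` P n - {{}} = (`) h ` P n" using \<open>{} \<notin> P n\<close> by auto
    ultimately show ?thesis using surj by simp
  qed
  have "clopen_partition ((`) h ` P n)" for n
    using decreasing_null_partition[OF P, of n] part[of n] cont(2)
    unfolding clopen_partition_def by (auto simp: vim open_vimage closed_vimage)
  moreover have "refines UNIV ((`) h ` P (Suc n)) ((`) h ` P n)" for n
  proof -
    have "\<forall>a\<in>P (Suc n). \<exists>b\<in>P n. a \<subseteq> b"
      using P unfolding decreasing_null_def refines_def by blast
    then have "\<exists>c\<in>(`) h ` P n. h ` a \<subseteq> c" if "a \<in> P (Suc n)" for a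
      using image_mono[of a _ h] that by (meson imageI)
    then show ?thesis unfolding refines_def using part by simp
  qed
  moreover have "(\<lambda>n. mesh ((`) h ` P n)) \<longlonglongrightarrow> 0"
  proof (rule mesh_tendsto_0_iff[THEN iffD2])
    show "\<forall>k. \<forall>\<^sub>F n in sequentially. \<forall>a\<in>(`) h ` P n. small k a"
    proof
      fix k
      obtain m where m: "\<And>s t. agree m s t \<Longrightarrow> agree k (h s) (h t)"
        using uniformly_continuous_agree[OF cont(1)] by blast
      show "\<forall>\<^sub>F n in sequentially. \<forall>a\<in>(`) h ` P n. small k a"
        using decreasing_null_small[OF P, of m]
        by eventually_elim (use m in \<open>auto simp: small_def\<close>)
    qed
  qed (use partition_finite decreasing_null_partition[OF P] in auto)
  ultimately show ?thesis unfolding decreasing_null_def by blast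
qed

lemma conjugates_imp_commuting:
  assumes "conjugates f g"
  shows "\<exists>P Q \<nu>. decreasing_null P \<and> decreasing_null Q \<and>
              (\<forall>n. pair_digraph_isomorphism (\<nu> n) (Gr f (P n)) (Gr g (Q n))) \<and>
              commutes_with_refinements P Q \<nu>"
proof -
  obtain h h' where h: "homeomorphism UNIV UNIV h h'" and f: "f = h' \<circ> g \<circ> h"
    using assms unfolding conjugates_def by blast
  have inj: "inj h" and hh': "\<And>x. h (h' x) = x"
    using h by (auto simp: homeomorphism_def inj_on_def) metis
  define P where "P n = range (cylinder n)" for n
  define Q where "Q n = (`) h ` P n" for n
  have P: "decreasing_null P" unfolding P_def using cylinder_partition_decreasing_null .
  have Q: "decreasing_null Q" unfolding Q_def using homeomorphism_image_decreasing_null[OF h P] .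
  have bij: "bij_betw ((`) h) (P n) (Q n)" for n
    unfolding Q_def bij_betw_def using inj by (simp add: inj_on_def inj_image_eq_iff)
  have "f ` a \<inter> b \<noteq> {} \<longleftrightarrow> g ` h ` a \<inter> h ` b \<noteq> {}" for a b
  proof -
    have "h ` (f ` a \<inter> b) = g ` h ` a \<inter> h ` b"
      by (simp add: image_Int[OF inj] image_comp f o_def hh')
    then show ?thesis by (metis image_is_empty)
  qed
  then have "pair_digraph_isomorphism ((`) h) (Gr f (P n)) (Gr g (Q n))" for n
    using bij[of n] unfolding pair_digraph_isomorphism_def Gr_def Q_def by simp
  moreover have "commutes_with_refinements P Q (\<lambda>n. (`) h)"
    unfolding commutes_with_refinements_iff[OF P Q bij] by blast
  ultimately show ?thesis using P Q by (intro exI[of _ P] exI[of _ Q] exI[of _ "\<lambda>n. (`) h"]) simp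
qed

section \<open>The map defined by asymptotically commuting isomorphisms\<close>

text \<open>
  The choice of the points does not matter for an asymptotically commuting \<open>\<nu>\<close> with nonempty
  values (\<open>tendsto_limit_map\<close> below); fixing one makes the map total.
\<close>

definition limit_map ::
  "(nat \<Rightarrow> cantor set set) \<Rightarrow> (nat \<Rightarrow> cantor set \<Rightarrow> cantor set) \<Rightarrow> cantor \<Rightarrow> cantor" where
  "limit_map P \<nu> x = (THE y. (\<lambda>n. SOME z. z \<in> \<nu> n (cell (P n) x)) \<longlonglongrightarrow> y)"

text \<open>
  From level \<open>n\<close> on, all the approximations to the limit at \<open>x\<close> stay in one set.
\<close>

lemma tilde_iso_cell:
  assumes P: "decreasing_null P" and "n \<le> m" "a \<in> P n" "x \<in> a"
  shows "\<nu> m (cell (P m) x) \<subseteq> tilde_iso P \<nu> n a"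
proof -
  note c = cell_in[OF decreasing_null_partition[OF P, of m], of x]
  have "cell (P m) x \<subseteq> a" using decreasing_null_subset[OF P \<open>n \<le> m\<close> c(1) \<open>a \<in> P n\<close> c(2) \<open>x \<in> a\<close>] .
  then show ?thesis using c \<open>n \<le> m\<close> unfolding tilde_iso_def extend_iso_def by blast
qed

lemma ex_cell_selection:
  assumes P: "decreasing_null P" and ne: "\<And>n a. a \<in> P n \<Longrightarrow> \<nu> n a \<noteq> {}"
  obtains s where "\<And>n. s n \<in> \<nu> n (cell (P n) x)"
proof -
  have "\<nu> n (cell (P n) x) \<noteq> {}" for n
    using cell_in(1)[OF decreasing_null_partition[OF P]] by (rule ne)
  then have "(SOME y. y \<in> \<nu> n (cell (P n) x)) \<in> \<nu> n (cell (P n) x)" for n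
    by (rule some_in_eq[THEN iffD2])
  then show ?thesis by (rule that)
qed

text \<open>
  Two points taken from approximations at levels beyond \<open>N\<close> lie in the same small set of
  level \<open>N\<close>. So every choice of points is a Cauchy sequence, and any two choices have the same
  limit.
\<close>

lemma tendsto_limit_map:
  assumes P: "decreasing_null P" and ac: "asymptotically_commutes_with_refinements P \<nu>"
    and s: "\<And>n. s n \<in> \<nu> n (cell (P n) x)"
  shows "s \<longlonglongrightarrow> limit_map P \<nu> x"
proof -
  have cauchy: "\<exists>N. \<forall>n\<ge>N. \<forall>m\<ge>N. \<forall>y\<in>\<nu> n (cell (P n) x). \<forall>z\<in>\<nu> m (cell (P m) x). agree k y z" for k
  proof -
    obtain N where N: "\<forall>a\<in>P N. small k (tilde_iso P \<nu> N a)"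
      using ac unfolding asymptotically_commutes_iff[OF P] eventually_sequentially by blast
    note c = cell_in[OF decreasing_null_partition[OF P, of N], of x]
    show ?thesis
      using N tilde_iso_cell[OF P _ c, of _ \<nu>] c(1) unfolding small_def by blast
  qed
  define r where "r n = (SOME y. y \<in> \<nu> n (cell (P n) x))" for n
  have r: "r n \<in> \<nu> n (cell (P n) x)" for n unfolding r_def
    using someI[of "\<lambda>y. y \<in> \<nu> n (cell (P n) x)", OF s] .
  have "\<exists>N. \<forall>n\<ge>N. agree k (r n) (r N)" for k using cauchy[of k] r by blast
  then obtain y where y: "r \<longlonglongrightarrow> y" using agree_Cauchy_convergent by blast
  have "\<forall>\<^sub>F n in sequentially. agree k (s n) (r n)" for k
    using cauchy[of k] r s unfolding eventually_sequentially by blast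
  then have "\<forall>\<^sub>F n in sequentially. agree k (s n) y" for k
    using y[unfolded tendsto_iff_agree, rule_format, of k]
    by (rule eventually_elim2) (rule agree_trans)
  then have "s \<longlonglongrightarrow> y" unfolding tendsto_iff_agree by blast
  moreover have "y = limit_map P \<nu> x"
    unfolding limit_map_def r_def[symmetric]
    using y cantor_LIMSEQ_unique by (intro the_equality[symmetric])
  ultimately show ?thesis by simp
qed

text \<open>
  The limit lies in the closure of the set attached to \<open>a\<close>; being \<open>small k\<close> passes to the
  closure, since agreement up to \<open>k\<close> is a closed condition.
\<close>

lemma limit_map_agree:
  assumes P: "decreasing_null P" and ac: "asymptotically_commutes_with_refinements P \<nu>"
    and ne: "\<And>n a. a \<in> P n \<Longrightarrow> \<nu> n a \<noteq> {}"
    and small: "small k (tilde_iso P \<nu> n a)" and a: "a \<in> P n" "x \<in> a"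
    and y: "y \<in> tilde_iso P \<nu> n a"
  shows "agree k (limit_map P \<nu> x) y"
proof -
  obtain s where s: "\<And>m. s m \<in> \<nu> m (cell (P m) x)"
    using ex_cell_selection[where \<nu> = \<nu> and x = x, OF P ne] by blast
  have "\<forall>\<^sub>F m in sequentially. agree k (s m) (limit_map P \<nu> x)"
    using tendsto_limit_map[OF P ac s] unfolding tendsto_iff_agree by blast
  then obtain m where m: "m \<ge> n" "agree k (s m) (limit_map P \<nu> x)"
    unfolding eventually_sequentially by (meson nat_le_linear)
  have "s m \<in> tilde_iso P \<nu> n a" using s tilde_iso_cell[OF P m(1) a] by blast
  then have "agree k (s m) y" using small y unfolding small_def by blast
  then show ?thesis using m(2) agree_sym agree_trans by blast
qed

lemma continuous_limit_map:
  assumes P: "decreasing_null P" and ac: "asymptotically_commutes_with_refinements P \<nu>"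
    and ne: "\<And>n a. a \<in> P n \<Longrightarrow> \<nu> n a \<noteq> {}"
  shows "continuous_on UNIV (limit_map P \<nu>)"
  unfolding continuous_iff_agree
proof (intro allI)
  fix x k
  obtain n where n: "\<forall>a\<in>P n. small k (tilde_iso P \<nu> n a)"
    using ac unfolding asymptotically_commutes_iff[OF P] eventually_sequentially by blast
  define a where "a = cell (P n) x"
  have a: "a \<in> P n" "x \<in> a"
    unfolding a_def using cell_in[OF decreasing_null_partition[OF P]] by auto
  have "open a" using a decreasing_null_partition[OF P] unfolding clopen_partition_def by blast
  then obtain m where m: "\<And>t. agree m x t \<Longrightarrow> t \<in> a" using a(2) unfolding open_iff_agree by blast
  have "\<nu> n a \<subseteq> tilde_iso P \<nu> n a"
    using tilde_iso_cell[OF P order_refl a, of \<nu>] by (simp add: a_def)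
  then obtain y where y: "y \<in> tilde_iso P \<nu> n a" using ne[OF a(1)] by blast
  have "agree k (limit_map P \<nu> t) y" if "t \<in> a" for t
    using limit_map_agree[OF P ac ne _ a(1) that y] n a(1) by blast
  then have "agree k (limit_map P \<nu> x) (limit_map P \<nu> t)" if "agree m x t" for t
    using m[OF that] a(2) agree_sym agree_trans by meson
  then show "\<exists>m. \<forall>t. agree m x t \<longrightarrow> agree k (limit_map P \<nu> x) (limit_map P \<nu> t)" by blast
qed

text \<open>
  Both \<open>x\<close> and its image under the composition agree up to \<open>k\<close> with a point of the small set
  attached to the member \<open>b\<close> of \<open>Q\<^sub>N\<close> around \<open>y = limit_map P \<nu> x\<close>: the image because
  \<open>y \<in> b\<close>, and \<open>x\<close> because \<open>b\<close> also contains \<open>\<nu>\<^sub>m(a)\<close> for a late level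
  \<open>m\<close>, where \<open>a\<close> is the member of \<open>P\<^sub>m\<close> around \<open>x\<close>. Openness of \<open>b\<close>
  is what gives such an \<open>m\<close>.
\<close>

lemma limit_map_inverse:
  assumes P: "decreasing_null P" and Q: "decreasing_null Q"
    and acP: "asymptotically_commutes_with_refinements P \<nu>"
    and acQ: "asymptotically_commutes_with_refinements Q \<mu>"
    and \<nu>: "\<And>n a. a \<in> P n \<Longrightarrow> \<nu> n a \<in> Q n" and \<mu>: "\<And>n b. b \<in> Q n \<Longrightarrow> \<mu> n b \<in> P n"
    and inv: "\<And>n a. a \<in> P n \<Longrightarrow> \<mu> n (\<nu> n a) = a"
  shows "limit_map Q \<mu> (limit_map P \<nu> x) = x"
proof (rule agree_all_eq)
  fix k
  define y where "y = limit_map P \<nu> x"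
  note partP = decreasing_null_partition[OF P] and partQ = decreasing_null_partition[OF Q]
  obtain N where N: "\<forall>b\<in>Q N. small k (tilde_iso Q \<mu> N b)"
    using acQ unfolding asymptotically_commutes_iff[OF Q] eventually_sequentially by blast
  define b where "b = cell (Q N) y"
  have b: "b \<in> Q N" "y \<in> b" unfolding b_def using cell_in[OF partQ] by auto
  obtain s where s: "\<And>m. s m \<in> \<nu> m (cell (P m) x)"
    using ex_cell_selection[where \<nu> = \<nu> and x = x, OF P partition_nonempty[OF partQ \<nu>]] by blast
  have "open b" using b partQ unfolding clopen_partition_def by blast
  then have "\<forall>\<^sub>F m in sequentially. s m \<in> b"
    using topological_tendstoD[OF tendsto_limit_map[OF P acP s]] b(2) y_def by blast
  then obtain m where m: "m \<ge> N" "s m \<in> b"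
    unfolding eventually_sequentially by (meson nat_le_linear)
  define a where "a = cell (P m) x"
  have a: "a \<in> P m" "x \<in> a" unfolding a_def using cell_in[OF partP] by auto
  have "cell (Q m) (s m) = \<nu> m a" using cell_eq[OF partQ] \<nu>[OF a(1)] s a_def by blast
  then have "a \<subseteq> tilde_iso Q \<mu> N b"
    using tilde_iso_cell[OF Q m(1) b(1) m(2), of \<mu>] inv[OF a(1)] by simp
  then have "x \<in> tilde_iso Q \<mu> N b" using a by blast
  moreover have "\<mu> n b \<noteq> {}" if "b \<in> Q n" for n b
    using \<mu>[OF that] partition_nonempty[OF partP] by blast
  ultimately show "agree k (limit_map Q \<mu> (limit_map P \<nu> x)) x"
    using limit_map_agree[OF Q acQ _ _ b] N b(1) y_def by blast
qed

section \<open>The characterization of conjugacy\<close>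

text \<open>
  The image of the edge from the member around \<open>x\<close> to the member around \<open>f(x)\<close> says that
  \<open>g\<close> moves some point near \<open>h(x)\<close> to a point near \<open>h(f(x))\<close>, and continuity of \<open>g\<close>
  makes this an equation.
\<close>

lemma asymptotically_commuting_imp_conjugates:
  assumes g: "continuous_on UNIV g" and P: "decreasing_null P" and Q: "decreasing_null Q"
    and iso: "\<And>n. pair_digraph_isomorphism (\<nu> n) (Gr f (P n)) (Gr g (Q n))"
    and acP: "asymptotically_commutes_with_refinements P \<nu>"
    and acQ: "asymptotically_commutes_with_refinements Q (\<lambda>n. inv_into (P n) (\<nu> n))"
  shows "conjugates f g"
proof -
  note partP = decreasing_null_partition[OF P] and partQ = decreasing_null_partition[OF Q]
  define \<mu> where "\<mu> = (\<lambda>n. inv_into (P n) (\<nu> n))"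
  have bij: "bij_betw (\<nu> n) (P n) (Q n)" for n
    using iso[of n] by (simp add: pair_digraph_isomorphism_def Gr_def)
  have \<nu>: "\<nu> n a \<in> Q n" "\<mu> n (\<nu> n a) = a" if "a \<in> P n" for n a
    using that bij[of n] by (auto simp: \<mu>_def bij_betw_inv_into_left bij_betw_apply)
  have \<mu>: "\<mu> n b \<in> P n" "\<nu> n (\<mu> n b) = b" if "b \<in> Q n" for n b
    using that bij_betw_apply[OF bij_betw_inv_into[OF bij[of n]]] bij[of n]
    by (auto simp: \<mu>_def bij_betw_inv_into_right)
  have acQ: "asymptotically_commutes_with_refinements Q \<mu>" using acQ by (simp add: \<mu>_def)
  define h where "h = limit_map P \<nu>"
  define h' where "h' = limit_map Q \<mu>"
  have h'h: "h' (h x) = x" for x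
    unfolding h_def h'_def using P Q acP acQ \<nu>(1) \<mu>(1) \<nu>(2) by (rule limit_map_inverse)
  have hh': "h (h' x) = x" for x
    unfolding h_def h'_def using Q P acQ acP \<mu>(1) \<nu>(1) \<mu>(2) by (rule limit_map_inverse)
  have "continuous_on UNIV h" unfolding h_def using P acP
    by (rule continuous_limit_map) (use \<nu>(1) partition_nonempty[OF partQ] in blast)
  moreover have "continuous_on UNIV h'" unfolding h'_def using Q acQ
    by (rule continuous_limit_map) (use \<mu>(1) partition_nonempty[OF partP] in blast)
  ultimately have "homeomorphism UNIV UNIV h h'"
    by (intro homeomorphismI) (auto simp: h'h hh')
  moreover have "h (f x) = g (h x)" for x
  proof -
    have "\<exists>z \<in> \<nu> n (cell (P n) x). g z \<in> \<nu> n (cell (P n) (f x))" for n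
    proof -
      have "(cell (P n) x, cell (P n) (f x)) \<in> parcs (Gr f (P n))"
        using cell_in[OF partP[of n], of x] cell_in[OF partP[of n], of "f x"] by (auto simp: Gr_def)
      then have "(\<nu> n (cell (P n) x), \<nu> n (cell (P n) (f x))) \<in> parcs (Gr g (Q n))"
        using iso[of n] cell_in(1)[OF partP[of n]]
        unfolding pair_digraph_isomorphism_def by (simp add: Gr_def[of f])
      then show ?thesis by (auto simp: Gr_def)
    qed
    then obtain z where z: "\<And>n. z n \<in> \<nu> n (cell (P n) x)"
      "\<And>n. g (z n) \<in> \<nu> n (cell (P n) (f x))" by metis
    have "z \<longlonglongrightarrow> h x" unfolding h_def using P acP z(1) by (rule tendsto_limit_map)
    then have "(\<lambda>n. g (z n)) \<longlonglongrightarrow> g (h x)" using g continuous_on_tendsto_compose by fastforce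
    moreover have "(\<lambda>n. g (z n)) \<longlonglongrightarrow> h (f x)"
      unfolding h_def using P acP z(2) by (rule tendsto_limit_map)
    ultimately show ?thesis using cantor_LIMSEQ_unique by blast
  qed
  then have "f = h' \<circ> g \<circ> h" using h'h by (metis comp_apply ext)
  ultimately show ?thesis unfolding conjugates_def by blast
qed

theorem theorem3p2:
  fixes f g :: "cantor \<Rightarrow> cantor"
  assumes "continuous_on UNIV f" and "continuous_on UNIV g"
  shows "(conjugates f g \<longleftrightarrow>
           (\<exists>P Q \<nu>. decreasing_null P \<and> decreasing_null Q \<and>
              (\<forall>n. pair_digraph_isomorphism (\<nu> n) (Gr f (P n)) (Gr g (Q n))) \<and>
              commutes_with_refinements P Q \<nu>)) \<and>
         (conjugates f g \<longleftrightarrow>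
           (\<exists>P Q \<nu>. decreasing_null P \<and> decreasing_null Q \<and>
              (\<forall>n. pair_digraph_isomorphism (\<nu> n) (Gr f (P n)) (Gr g (Q n))) \<and>
              asymptotically_commutes_with_refinements P \<nu> \<and>
              asymptotically_commutes_with_refinements Q (\<lambda>n. inv_into (P n) (\<nu> n))))"
    (is "(?i \<longleftrightarrow> ?ii) \<and> (?i \<longleftrightarrow> ?iii)")
proof -
  have "?i \<Longrightarrow> ?ii" by (rule conjugates_imp_commuting)
  moreover have "?ii \<Longrightarrow> ?iii" using commuting_imp_asymptotically_commuting by blast
  moreover have "?iii \<Longrightarrow> ?i" using asymptotically_commuting_imp_conjugates[OF assms(2)] by blast
  ultimately show ?thesis by argo
qed

end
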